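(* Let $\mu_1,\mu_2>0$, let $a>1$, $b>1$, $c\ge0$ satisfy $(a-1)(b-1)\ge(c-1)^2$, and put $\Sigma_{11}=a\mu_1^2$, $\Sigma_{22}=b\mu_2^2$, $\Sigma_{12}=c\mu_1\mu_2$, $\theta=(\mu_1,\mu_2,\Sigma_{11},\Sigma_{22},\Sigma_{12})$. Let $K\ge1$ and let $W=(w_{ik})\in\mathbb R^{6\times K}$. For $k=1,\dots,K$ define $$\ell_k(\boldsymbol X)=w_{1k}+w_{2k}X_1+w_{3k}X_2+w_{4k}X_1^2+w_{5k}X_2^2+w_{6k}X_1X_2 .$$ Then the bivariate moment problem $$\sup_{\mathbb P\in\mathcal F(\theta)}\ \mathbb E_{\mathbb P}\Big[\max_{k=1,\dots,K}\ell_k(\boldsymbol X)\Big]$$ can be solved by a semidefinite program: its optimal value equals the optimal value of $$\inf_{\boldsymbol z,G,H}\ z_1+\mu_1z_2+\mu_2z_3+\Sigma_{11}z_4+\Sigma_{22}z_5+\Sigma_{12}z_6\quad\text{s.t.}\quad M\big(\boldsymbol z-\boldsymbol w^{(k)},\boldsymbol g^{(k)},\boldsymbol h^{(k)}\big)\succeq0,\quad k=1,\dots,K,$$ where the infimum is over $\boldsymbol z\in\mathbb R^6$, $G\in\mathbb R^{3\times K}$, $H\in\mathbb R^{3\times K}$, and $\boldsymbol w^{(k)},\boldsymbol g^{(k)},\boldsymbol h^{(k)}$ denote the $k$-th columns of $W,G,H$ respectively.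
   Context: $\mathcal F(\theta)$ is the set of all probability distributions $\mathbb P$ of a random vector $\boldsymbol X=(X_1,X_2)$ supported on $\mathbb R_+^2=[0,\infty)^2$ such that $\mathbb E_{\mathbb P}[X_1]=\mu_1$, $\mathbb E_{\mathbb P}[X_2]=\mu_2$, $\mathbb E_{\mathbb P}[X_1^2]=\Sigma_{11}$, $\mathbb E_{\mathbb P}[X_2^2]=\Sigma_{22}$, $\mathbb E_{\mathbb P}[X_1X_2]=\Sigma_{12}$. For $\tilde{\boldsymbol z}\in\mathbb R^6$ and $\boldsymbol g,\boldsymbol h\in\mathbb R^3$, the symmetric $6\times6$ matrix $M(\tilde{\boldsymbol z},\boldsymbol g,\boldsymbol h)$ is $$\begin{pmatrix} \tilde z_4&0&-g_1&0&-h_1&-g_2\\ 0&\tilde z_6+2g_1&0&h_1&-h_2&-h_3\\ -g_1&0&\tilde z_5&h_2&0&-g_3\\ 0&h_1&h_2&\tilde z_2+2g_2&h_3&0\\ -h_1&-h_2&0&h_3&\tilde z_3+2g_3&0\\ -g_2&-h_3&-g_3&0&0&\tilde z_1 \end{pmatrix},$$ and $\succeq0$ means positive semidefinite. *)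

theory Defs
  imports "HOL-Probability.Probability"
begin

text \<open>
  The distributions in \<open>\<F>(\<theta>)\<close> are Borel probability measures on \<open>real^2\<close>; the random vector
  is the identity map. Since the Bochner integral of a non-integrable function is \<open>0\<close>, the moment
  conditions are stated with \<open>has_bochner_integral\<close>, which includes integrability.
\<close>

definition moment_dists :: "real \<Rightarrow> real \<Rightarrow> real \<Rightarrow> real \<Rightarrow> real \<Rightarrow> (real^2) measure set" where
  "moment_dists \<mu>\<^sub>1 \<mu>\<^sub>2 \<Sigma>\<^sub>1\<^sub>1 \<Sigma>\<^sub>2\<^sub>2 \<Sigma>\<^sub>1\<^sub>2 =
    {P. prob_space P \<and> sets P = sets borel \<and>
        (AE x in P. 0 \<le> x$1 \<and> 0 \<le> x$2) \<and>
        has_bochner_integral P (\<lambda>x. x$1) \<mu>\<^sub>1 \<and>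
        has_bochner_integral P (\<lambda>x. x$2) \<mu>\<^sub>2 \<and>
        has_bochner_integral P (\<lambda>x. (x$1)\<^sup>2) \<Sigma>\<^sub>1\<^sub>1 \<and>
        has_bochner_integral P (\<lambda>x. (x$2)\<^sup>2) \<Sigma>\<^sub>2\<^sub>2 \<and>
        has_bochner_integral P (\<lambda>x. x$1 * x$2) \<Sigma>\<^sub>1\<^sub>2}"

definition quad_fun :: "real^6 \<Rightarrow> real^2 \<Rightarrow> real" where
  "quad_fun w x = w$1 + w$2 * x$1 + w$3 * x$2 + w$4 * (x$1)\<^sup>2 + w$5 * (x$2)\<^sup>2 + w$6 * (x$1 * x$2)"

definition psd :: "real^'n^'n \<Rightarrow> bool" where
  "psd A \<longleftrightarrow> transpose A = A \<and> (\<forall>x. 0 \<le> x \<bullet> (A *v x))"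

text \<open>
  \<open>lmi_matrix z g h\<close> is the general Gram matrix, with respect to the monomials
  \<open>(s\<^sup>2, s*t, t\<^sup>2, s, t, 1)\<close>, of the quartic obtained from \<open>quad_fun z\<close> by substituting
  \<open>(s\<^sup>2, t\<^sup>2)\<close>; the entries of \<open>g\<close> and \<open>h\<close> are the free parameters.
\<close>

definition lmi_matrix :: "real^6 \<Rightarrow> real^3 \<Rightarrow> real^3 \<Rightarrow> real^6^6" where
  "lmi_matrix z g h = vector
    [vector [ z$4,  0,             - g$1, 0,             - h$1,         - g$2],
     vector [ 0,    z$6 + 2 * g$1, 0,     h$1,           - h$2,         - h$3],
     vector [- g$1, 0,             z$5,   h$2,           0,             - g$3],
     vector [ 0,    h$1,           h$2,   z$2 + 2 * g$2, h$3,           0],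
     vector [- h$1, - h$2,         0,     h$3,           z$3 + 2 * g$3, 0],
     vector [- g$2, - h$3,         - g$3, 0,             0,             z$1]]"

end

theory Submission
  imports Defs
begin

text \<open>
  Weak duality: a feasible point makes \<open>quad_fun z\<close> dominate every piece on the quadrant. Conversely,
  the homogenised pieces are linear in the moments of a vector \<open>y \<ge> 0\<close> in \<open>real^3\<close>, and the cone
  generated by the pairs (moments, value) of such vectors is closed. Separating a pair
  that has the given moments from this cone yields a \<open>z\<close> that is copositive relative to every piece,
  and a copositive ternary form dominates, off the diagonal, a positive semidefinite one; this gives
  the matrices with \<open>h = 0\<close>. It remains to see that the atoms at infinity (\<open>y$1 = 0\<close>) do not increase
  the supremum: each of them can be rotated into a finite one against a small part of a fixed finite
  atom whose support is at least as large. Such an atom exists also when the moments are on the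
  boundary of the moment cone, because if \<open>E[X\<^sub>1 X\<^sub>2] = 0\<close> then all atoms are on the axes.
\<close>

section \<open>Coordinates of \<open>real^6\<close> and the homogeneous moment vector\<close>

lemma UNIV_6: "UNIV = {1, 2, 3, 4, 5, 6::6}"
proof -
  have "x = 1 \<or> x = 2 \<or> x = 3 \<or> x = 4 \<or> x = 5 \<or> x = 6" for x :: 6
  proof (induct x)
    case (of_int z)
    then have "z = 0 \<or> z = 1 \<or> z = 2 \<or> z = 3 \<or> z = 4 \<or> z = 5"
      by fastforce
    then show ?case
      by auto
  qed
  then show ?thesis
    by auto
qed

lemma forall_6: "(\<forall>i::6. P i) \<longleftrightarrow> P 1 \<and> P 2 \<and> P 3 \<and> P 4 \<and> P 5 \<and> P 6"
  using UNIV_6 by (metis (full_types) UNIV_I empty_iff insert_iff)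

lemma sum_6: "sum f (UNIV::6 set) = f 1 + f 2 + f 3 + f 4 + f 5 + f 6"
  unfolding UNIV_6 by (simp add: ac_simps)

lemma vector_6 [simp]:
  "(vector [x1, x2, x3, x4, x5, x6] :: 'a::zero^6) $ 1 = x1"
  "(vector [x1, x2, x3, x4, x5, x6] :: 'a::zero^6) $ 2 = x2"
  "(vector [x1, x2, x3, x4, x5, x6] :: 'a::zero^6) $ 3 = x3"
  "(vector [x1, x2, x3, x4, x5, x6] :: 'a::zero^6) $ 4 = x4"
  "(vector [x1, x2, x3, x4, x5, x6] :: 'a::zero^6) $ 5 = x5"
  "(vector [x1, x2, x3, x4, x5, x6] :: 'a::zero^6) $ 6 = x6"
  unfolding vector_def by simp_all

lemma inner_6: "x \<bullet> y = x$1 * y$1 + x$2 * y$2 + x$3 * y$3 + x$4 * y$4 + x$5 * y$5 + x$6 * y$6"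
  for x y :: "real^6"
  by (simp add: inner_vec_def sum_6)

text \<open>The entries of the rank-one matrix y y^T, ordered like the coefficients of
  \<open>quad_fun\<close>. The coordinate \<open>y$1\<close> homogenises:
  \<open>vector [1, x$1, x$2]\<close> is a unit atom at \<open>x\<close>, and \<open>y$1 = 0\<close>
  is a direction at infinity.\<close>

definition mom :: "real^3 \<Rightarrow> real^6" where
  "mom y = vector [(y$1)\<^sup>2, y$1 * y$2, y$1 * y$3, (y$2)\<^sup>2, (y$3)\<^sup>2, y$2 * y$3]"

lemma quad_fun_eq_mom: "quad_fun w x = w \<bullet> mom (vector [1, x$1, x$2])"
  by (simp add: quad_fun_def mom_def inner_6)

section \<open>The matrix inequality as a certificate of nonnegativity\<close>

lemma lmi_matrix_form:
  "x \<bullet> (lmi_matrix z g h *v x) =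
     z$4 * (x$1)\<^sup>2 + z$5 * (x$3)\<^sup>2 + z$1 * (x$6)\<^sup>2
     + (z$6 + 2 * g$1) * (x$2)\<^sup>2 + (z$2 + 2 * g$2) * (x$4)\<^sup>2 + (z$3 + 2 * g$3) * (x$5)\<^sup>2
     - 2 * g$1 * (x$1 * x$3) - 2 * g$2 * (x$1 * x$6) - 2 * g$3 * (x$3 * x$6)
     + 2 * h$1 * (x$2 * x$4 - x$1 * x$5) + 2 * h$2 * (x$3 * x$4 - x$2 * x$5)
     + 2 * h$3 * (x$4 * x$5 - x$2 * x$6)"
  by (simp add: inner_6 matrix_vector_mult_def sum_6 lmi_matrix_def power2_eq_square algebra_simps)

lemma transpose_lmi_matrix: "transpose (lmi_matrix z g h) = lmi_matrix z g h"
  by (simp add: vec_eq_iff forall_6 transpose_def lmi_matrix_def)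

text \<open>Each entry of \<open>g\<close> and \<open>h\<close> multiplies a binomial, such as
  (st)(st) - (s^2)(t^2), that vanishes at the vector of monomials; there the form is the quartic
  alone.\<close>

lemma quad_fun_nonneg_if_psd:
  assumes "psd (lmi_matrix z g h)" "0 \<le> x$1" "0 \<le> x$2"
  shows "0 \<le> quad_fun z x"
proof -
  define s t where "s = sqrt (x$1)" and "t = sqrt (x$2)"
  have st: "x$1 = s\<^sup>2" "x$2 = t\<^sup>2"
    using assms by (auto simp: s_def t_def)
  define v :: "real^6" where "v = vector [s\<^sup>2, s * t, t\<^sup>2, s, t, 1]"
  have "0 \<le> v \<bullet> (lmi_matrix z g h *v v)"
    using assms(1) by (simp add: psd_def)
  also have "\<dots> = quad_fun z x"
    unfolding lmi_matrix_form quad_fun_def v_def st vector_6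
    by (simp add: power2_eq_square algebra_simps)
  finally show ?thesis .
qed

section \<open>Copositive ternary forms\<close>

text \<open>Elimination with pivot \<open>d0\<close>: if the Schur complement has a negative off-diagonal entry, its form
  is smallest on nonnegative vectors, where the eliminated variable is nonnegative too.\<close>

lemma copositive_3_pivot:
  fixes d0 d1 d2 \<alpha> \<beta> \<gamma> :: real
  assumes cop: "\<And>x0 x1 x2. \<lbrakk>0 \<le> x0; 0 \<le> x1; 0 \<le> x2\<rbrakk> \<Longrightarrow>
      0 \<le> d0 * x0\<^sup>2 + d1 * x1\<^sup>2 + d2 * x2\<^sup>2 + 2 * \<alpha> * x1 * x2 + 2 * \<beta> * x0 * x1 + 2 * \<gamma> * x0 * x2"
    and "\<beta> \<le> 0" "\<gamma> \<le> 0"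
  shows "\<exists>\<alpha>'\<le>\<alpha>. \<forall>x0 x1 x2.
      0 \<le> d0 * x0\<^sup>2 + d1 * x1\<^sup>2 + d2 * x2\<^sup>2 + 2 * \<alpha>' * x1 * x2 + 2 * \<beta> * x0 * x1 + 2 * \<gamma> * x0 * x2"
proof -
  have d: "0 \<le> d0" "0 \<le> d1" "0 \<le> d2"
    using cop[of 1 0 0] cop[of 0 1 0] cop[of 0 0 1] by auto
  \<comment> \<open>With \<open>d0 = 0\<close> the form is linear in \<open>x0\<close>, so a
    negative \<beta> or \<gamma> makes it negative for large \<open>x0\<close>; the witness for
    \<beta> brings it to \<open>- d1 + 2 * \<beta>\<close>.\<close>
  have zero: "\<beta> = 0 \<and> \<gamma> = 0" if "d0 = 0"
  proof -
    have "0 \<le> \<beta>"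
    proof (rule ccontr)
      assume n: "\<not> 0 \<le> \<beta>"
      have "0 \<le> d1 + 2 * \<beta> * (d1 / (- \<beta>) + 1)"
        using cop[of "d1 / (- \<beta>) + 1" 1 0] d that n by (simp add: divide_simps)
      also have "\<dots> = - d1 + 2 * \<beta>"
        using n by (simp add: field_simps)
      finally show False using n d by simp
    qed
    moreover have "0 \<le> \<gamma>"
    proof (rule ccontr)
      assume n: "\<not> 0 \<le> \<gamma>"
      have "0 \<le> d2 + 2 * \<gamma> * (d2 / (- \<gamma>) + 1)"
        using cop[of "d2 / (- \<gamma>) + 1" 0 1] d that n by (simp add: divide_simps)
      also have "\<dots> = - d2 + 2 * \<gamma>"
        using n by (simp add: field_simps)
      finally show False using n d by simp
    qed
    ultimately show ?thesis
      using assms by simp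
  qed
  define \<sigma> where "\<sigma> = \<beta> * \<gamma> / d0"
  define e1 e2 where "e1 = d1 - \<beta>\<^sup>2 / d0" and "e2 = d2 - \<gamma>\<^sup>2 / d0"
  \<comment> \<open>Division by \<open>d0 = 0\<close> yields 0, and by \<open>zero\<close> both
    sides then agree.\<close>
  have schur: "d0 * x0\<^sup>2 + d1 * x1\<^sup>2 + d2 * x2\<^sup>2 + 2 * a * x1 * x2 + 2 * \<beta> * x0 * x1 + 2 * \<gamma> * x0 * x2
      = d0 * (x0 + (\<beta> * x1 + \<gamma> * x2) / d0)\<^sup>2 + (e1 * x1\<^sup>2 + e2 * x2\<^sup>2 + 2 * (a - \<sigma>) * x1 * x2)"
    for a x0 x1 x2
  proof (cases "d0 = 0")
    case True
    then show ?thesis using zero by (simp add: e1_def e2_def \<sigma>_def)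
  next
    case False
    then show ?thesis
      unfolding e1_def e2_def \<sigma>_def by (simp add: field_simps power2_eq_square)
  qed
  \<comment> \<open>The form is smallest in \<open>x0\<close> at
    \<open>- (\<beta> * x1 + \<gamma> * x2) / d0\<close>, which is nonnegative because \<beta> and
    \<gamma> are not positive.\<close>
  have red: "0 \<le> e1 * x1\<^sup>2 + e2 * x2\<^sup>2 + 2 * (\<alpha> - \<sigma>) * x1 * x2" if "0 \<le> x1" "0 \<le> x2" for x1 x2
  proof -
    have "0 \<le> - (\<beta> * x1 + \<gamma> * x2) / d0"
      using mult_nonpos_nonneg[OF \<open>\<beta> \<le> 0\<close> that(1)] mult_nonpos_nonneg[OF \<open>\<gamma> \<le> 0\<close> that(2)] d
      by (intro divide_nonneg_nonneg) linarith+
    from cop[OF this that] show ?thesis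
      unfolding schur add_divide_distrib[symmetric] by simp
  qed
  have e: "0 \<le> e1" "0 \<le> e2"
    using red[of 1 0] red[of 0 1] by auto
  \<comment> \<open>At \<sigma> the Schur complement is diagonal. Capping \<alpha> there keeps its
    off-diagonal entry from being positive.\<close>
  define \<alpha>' where "\<alpha>' = min \<alpha> \<sigma>"
  have "0 \<le> e1 * x1\<^sup>2 + e2 * x2\<^sup>2 + 2 * (\<alpha>' - \<sigma>) * x1 * x2" for x1 x2
  proof (cases "\<alpha> \<le> \<sigma>")
    case True
    have "(\<alpha> - \<sigma>) * (\<bar>x1\<bar> * \<bar>x2\<bar>) \<le> (\<alpha> - \<sigma>) * (x1 * x2)"
      using True by (intro mult_left_mono_neg) (auto simp: abs_mult[symmetric])
    with red[of "\<bar>x1\<bar>" "\<bar>x2\<bar>"] show ?thesis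
      using True by (simp add: \<alpha>'_def min_def algebra_simps)
  next
    case False
    then show ?thesis using e by (simp add: \<alpha>'_def min_def)
  qed
  then have "0 \<le> d0 * x0\<^sup>2 + d1 * x1\<^sup>2 + d2 * x2\<^sup>2 + 2 * \<alpha>' * x1 * x2 + 2 * \<beta> * x0 * x1 + 2 * \<gamma> * x0 * x2"
    for x0 x1 x2
    unfolding schur using d by simp
  moreover have "\<alpha>' \<le> \<alpha>" by (simp add: \<alpha>'_def)
  ultimately show ?thesis by blast
qed

text \<open>Nonnegative \<beta> and \<gamma> can be lowered to 0: the form then splits into a square
  in \<open>x0\<close> and a copositive form in the other variables, which the pivot lemma
  handles.\<close>

lemma copositive_3_same_sign:
  fixes d0 d1 d2 \<alpha> \<beta> \<gamma> :: real
  assumes cop: "\<And>x0 x1 x2. \<lbrakk>0 \<le> x0; 0 \<le> x1; 0 \<le> x2\<rbrakk> \<Longrightarrow>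
      0 \<le> d0 * x0\<^sup>2 + d1 * x1\<^sup>2 + d2 * x2\<^sup>2 + 2 * \<alpha> * x1 * x2 + 2 * \<beta> * x0 * x1 + 2 * \<gamma> * x0 * x2"
    and sgn: "\<beta> \<le> 0 \<and> \<gamma> \<le> 0 \<or> 0 \<le> \<beta> \<and> 0 \<le> \<gamma>"
  shows "\<exists>\<alpha>' \<beta>' \<gamma>'. \<alpha>' \<le> \<alpha> \<and> \<beta>' \<le> \<beta> \<and> \<gamma>' \<le> \<gamma> \<and> (\<forall>x0 x1 x2.
      0 \<le> d0 * x0\<^sup>2 + d1 * x1\<^sup>2 + d2 * x2\<^sup>2 + 2 * \<alpha>' * x1 * x2 + 2 * \<beta>' * x0 * x1 + 2 * \<gamma>' * x0 * x2)"
  using sgn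
proof
  assume "\<beta> \<le> 0 \<and> \<gamma> \<le> 0"
  then show ?thesis
    using copositive_3_pivot[of d0 d1 d2 \<alpha> \<beta> \<gamma>] cop by blast
next
  assume pos: "0 \<le> \<beta> \<and> 0 \<le> \<gamma>"
  have "0 \<le> d0 * x0\<^sup>2 + d1 * x1\<^sup>2 + d2 * x2\<^sup>2 + 2 * \<alpha> * x1 * x2 + 2 * 0 * x0 * x1 + 2 * 0 * x0 * x2"
    if "0 \<le> x1" "0 \<le> x2" for x0 x1 x2
  proof -
    have "0 \<le> d0" using cop[of 1 0 0] by simp
    then have "0 \<le> d0 * x0\<^sup>2" by simp
    with cop[of 0 x1 x2] that show ?thesis by simp
  qed
  from copositive_3_pivot[of d0 d1 d2 \<alpha> 0 0, OF this] show ?thesis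
    using pos by blast
qed

text \<open>In dimension 3 a copositive matrix is a positive semidefinite one plus a nonnegative
  one. Two of the three off-diagonal signs agree, and those two entries share a variable, which a
  permutation makes the pivot.\<close>

lemma copositive_3:
  fixes d0 d1 d2 \<alpha> \<beta> \<gamma> :: real
  assumes cop: "\<And>x0 x1 x2. \<lbrakk>0 \<le> x0; 0 \<le> x1; 0 \<le> x2\<rbrakk> \<Longrightarrow>
      0 \<le> d0 * x0\<^sup>2 + d1 * x1\<^sup>2 + d2 * x2\<^sup>2 + 2 * \<alpha> * x1 * x2 + 2 * \<beta> * x0 * x1 + 2 * \<gamma> * x0 * x2"
  obtains \<alpha>' \<beta>' \<gamma>' where "\<alpha>' \<le> \<alpha>" "\<beta>' \<le> \<beta>" "\<gamma>' \<le> \<gamma>"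
    "\<And>x0 x1 x2.
      0 \<le> d0 * x0\<^sup>2 + d1 * x1\<^sup>2 + d2 * x2\<^sup>2 + 2 * \<alpha>' * x1 * x2 + 2 * \<beta>' * x0 * x1 + 2 * \<gamma>' * x0 * x2"
proof -
  consider "\<beta> \<le> 0 \<and> \<gamma> \<le> 0 \<or> 0 \<le> \<beta> \<and> 0 \<le> \<gamma>" | "\<beta> \<le> 0 \<and> \<alpha> \<le> 0 \<or> 0 \<le> \<beta> \<and> 0 \<le> \<alpha>"
    | "\<gamma> \<le> 0 \<and> \<alpha> \<le> 0 \<or> 0 \<le> \<gamma> \<and> 0 \<le> \<alpha>"
    by linarith
  then show ?thesis
  proof cases
    case 1
    then show ?thesis
      using copositive_3_same_sign[of d0 d1 d2 \<alpha> \<beta> \<gamma>] cop that by blast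
  next
    case 2
    have "0 \<le> d1 * x0\<^sup>2 + d0 * x1\<^sup>2 + d2 * x2\<^sup>2 + 2 * \<gamma> * x1 * x2 + 2 * \<beta> * x0 * x1 + 2 * \<alpha> * x0 * x2"
      if "0 \<le> x0" "0 \<le> x1" "0 \<le> x2" for x0 x1 x2
      using cop[OF that(2,1,3)] by (simp add: algebra_simps)
    from copositive_3_same_sign[of d1 d0 d2 \<gamma> \<beta> \<alpha>, OF this 2] obtain \<alpha>' \<beta>' \<gamma>'
      where *: "\<gamma>' \<le> \<gamma>" "\<beta>' \<le> \<beta>" "\<alpha>' \<le> \<alpha>" and psd: "\<And>x0 x1 x2.
      0 \<le> d1 * x0\<^sup>2 + d0 * x1\<^sup>2 + d2 * x2\<^sup>2 + 2 * \<gamma>' * x1 * x2 + 2 * \<beta>' * x0 * x1 + 2 * \<alpha>' * x0 * x2"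
      by blast
    show ?thesis
    proof (rule that[OF *(3,2,1)])
      show "0 \<le> d0 * x0\<^sup>2 + d1 * x1\<^sup>2 + d2 * x2\<^sup>2 + 2 * \<alpha>' * x1 * x2 + 2 * \<beta>' * x0 * x1 + 2 * \<gamma>' * x0 * x2"
        for x0 x1 x2
        using psd[of x1 x0 x2] by (simp add: algebra_simps)
    qed
  next
    case 3
    have "0 \<le> d2 * x0\<^sup>2 + d0 * x1\<^sup>2 + d1 * x2\<^sup>2 + 2 * \<beta> * x1 * x2 + 2 * \<gamma> * x0 * x1 + 2 * \<alpha> * x0 * x2"
      if "0 \<le> x0" "0 \<le> x1" "0 \<le> x2" for x0 x1 x2
      using cop[OF that(2,3,1)] by (simp add: algebra_simps)
    from copositive_3_same_sign[of d2 d0 d1 \<beta> \<gamma> \<alpha>, OF this 3] obtain \<alpha>' \<beta>' \<gamma>'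
      where *: "\<gamma>' \<le> \<gamma>" "\<beta>' \<le> \<beta>" "\<alpha>' \<le> \<alpha>" and psd: "\<And>x0 x1 x2.
      0 \<le> d2 * x0\<^sup>2 + d0 * x1\<^sup>2 + d1 * x2\<^sup>2 + 2 * \<beta>' * x1 * x2 + 2 * \<gamma>' * x0 * x1 + 2 * \<alpha>' * x0 * x2"
      by blast
    show ?thesis
    proof (rule that[OF *(3,2,1)])
      show "0 \<le> d0 * x0\<^sup>2 + d1 * x1\<^sup>2 + d2 * x2\<^sup>2 + 2 * \<alpha>' * x1 * x2 + 2 * \<beta>' * x0 * x1 + 2 * \<gamma>' * x0 * x2"
        for x0 x1 x2
        using psd[of x2 x0 x1] by (simp add: algebra_simps)
    qed
  qed
qed

lemma psd_lmi_matrix_if_copositive: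
  assumes "\<And>y. \<forall>i. 0 \<le> y$i \<Longrightarrow> 0 \<le> z \<bullet> mom y"
  shows "\<exists>g. psd (lmi_matrix z g 0)"
proof -
  have "0 \<le> z$1 * x0\<^sup>2 + z$4 * x1\<^sup>2 + z$5 * x2\<^sup>2
      + 2 * (z$6 / 2) * x1 * x2 + 2 * (z$2 / 2) * x0 * x1 + 2 * (z$3 / 2) * x0 * x2"
    if "0 \<le> x0" "0 \<le> x1" "0 \<le> x2" for x0 x1 x2
    using assms[of "vector [x0, x1, x2]"] that
    by (simp add: forall_3 mom_def inner_6 algebra_simps)
  then obtain \<alpha> \<beta> \<gamma> where le: "\<alpha> \<le> z$6 / 2" "\<beta> \<le> z$2 / 2" "\<gamma> \<le> z$3 / 2"
    and psd: "\<And>x0 x1 x2. 0 \<le> z$1 * x0\<^sup>2 + z$4 * x1\<^sup>2 + z$5 * x2\<^sup>2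
      + 2 * \<alpha> * x1 * x2 + 2 * \<beta> * x0 * x1 + 2 * \<gamma> * x0 * x2"
    using copositive_3 by blast
  \<comment> \<open>The ternary form is read on the monomials 1, s^2, t^2, and the slack of its
    off-diagonal entries becomes the weight of the squares of st, s, t; this dictates
    \<open>g\<close>.\<close>
  have "0 \<le> x \<bullet> (lmi_matrix z (vector [- \<alpha>, - \<beta>, - \<gamma>]) 0 *v x)" for x
  proof -
    have "0 \<le> (z$6 - 2 * \<alpha>) * (x$2)\<^sup>2 + (z$2 - 2 * \<beta>) * (x$4)\<^sup>2 + (z$3 - 2 * \<gamma>) * (x$5)\<^sup>2"
      using le by simp
    with psd[of "x$6" "x$1" "x$3"] show ?thesis
      unfolding lmi_matrix_form by (simp add: algebra_simps)
  qed
  then show ?thesis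
    unfolding psd_def transpose_lmi_matrix by blast
qed

section \<open>The closed moment cone with atoms at infinity\<close>

definition nonneg3 :: "(real^3) set" where
  "nonneg3 = {y. \<forall>i. 0 \<le> y$i}"

definition lift :: "real^6 \<Rightarrow> real^6 \<Rightarrow> (real^6) \<times> real" where
  "lift w N = (N, w \<bullet> N)"

lemma lift_add: "lift w (M + N) = lift w M + lift w N"
  by (simp add: lift_def inner_add_right)

lemma lift_scaleR: "lift w (r *\<^sub>R N) = r *\<^sub>R lift w N"
  by (simp add: lift_def)

lemma mom_scaleR: "mom (r *\<^sub>R y) = r\<^sup>2 *\<^sub>R mom y"
  by (simp add: mom_def vec_eq_iff forall_6 power2_eq_square algebra_simps)

lemma mom_0 [simp]: "mom 0 = 0"
  by (simp add: mom_def vec_eq_iff forall_6)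

lemma continuous_on_mom: "continuous_on S mom"
proof -
  have "\<forall>i. continuous_on S (\<lambda>y. mom y $ i)"
    unfolding forall_6 mom_def vector_6 by (intro conjI continuous_intros)
  then have "continuous_on S (\<lambda>y. \<chi> i. mom y $ i)"
    by (intro continuous_on_vec_lambda) simp
  then show ?thesis
    by (simp add: vec_lambda_eta)
qed

text \<open>Compared with the atomic cone below, the generators with \<open>y$1 = 0\<close> represent mass that has
  escaped to infinity; they make the cone closed.\<close>

definition ext_cone :: "('k::finite \<Rightarrow> real^6) \<Rightarrow> ((real^6) \<times> real) set" where
  "ext_cone Q = convex_cone hull
     (insert (0, - 1) (\<Union>k. (\<lambda>y. lift (Q k) (mom y)) ` (nonneg3 \<inter> sphere 0 1)))"

lemma convex_cone_ext_cone: "convex_cone (ext_cone Q)"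
  by (simp add: ext_cone_def convex_cone_convex_cone_hull)

lemma lift_mom_in_ext_cone:
  assumes "y \<in> nonneg3"
  shows "lift (Q k) (mom y) \<in> ext_cone Q"
proof (cases "y = 0")
  case True
  then show ?thesis
    by (simp add: ext_cone_def lift_def zero_prod_def[symmetric] convex_cone_hull_contains_0)
next
  case False
  define u where "u = (1 / norm y) *\<^sub>R y"
  have u: "u \<in> nonneg3 \<inter> sphere 0 1" "y = norm y *\<^sub>R u"
    using False assms by (auto simp: u_def nonneg3_def)
  have "lift (Q k) (mom u) \<in> ext_cone Q"
    unfolding ext_cone_def using u(1) by (intro hull_inc insertI2 UN_I[of k] imageI) auto
  then show ?thesis
    by (subst u(2)) (simp add: mom_scaleR lift_scaleR ext_cone_def convex_cone_hull_mul)
qed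

text \<open>The conic hull of a compact convex set that misses 0 is closed; a functional strictly
  positive on the generators keeps 0 out of their convex hull.\<close>

lemma closed_ext_cone: "closed (ext_cone Q)"
proof -
  define A where "A = (\<Union>k. (\<lambda>y. lift (Q k) (mom y)) ` (nonneg3 \<inter> sphere 0 1))"
  have "closed nonneg3"
    unfolding nonneg3_def by (intro closed_Collect_all closed_Collect_le continuous_intros)
  then have "compact (nonneg3 \<inter> sphere 0 1)"
    using closed_Int_compact compact_sphere by blast
  then have "compact A"
    unfolding A_def lift_def
    by (intro compact_UN compact_continuous_image continuous_intros continuous_on_mom) auto
  then obtain B where B: "\<And>\<alpha>. \<alpha> \<in> A \<Longrightarrow> norm \<alpha> \<le> B"
    using compact_imp_bounded bounded_iff by metis
  \<comment> \<open>The functional \<open>n\<close> is the trace of y y^T minus \<kappa> times the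
    value. On unit vectors the trace is 1 and the value at most \<open>B\<close>, so
    \<open>\<kappa> * B < 1\<close> suffices; \<kappa> > 0 settles the generator
    \<open>(0, - 1)\<close>.\<close>
  define \<kappa> where "\<kappa> = 1 / (\<bar>B\<bar> + 1)"
  have \<kappa>: "\<kappa> > 0" "\<kappa> * B < 1"
    by (auto simp: \<kappa>_def divide_simps)
  define n :: "(real^6) \<times> real" where "n = (vector [1, 0, 0, 1, 1, 0], - \<kappa>)"
  have "0 < n \<bullet> \<alpha>" if \<alpha>: "\<alpha> \<in> A" for \<alpha>
  proof -
    obtain k y where y: "\<alpha> = lift (Q k) (mom y)" "norm y = 1"
      using \<alpha> unfolding A_def by fastforce
    have "vector [1, 0, 0, 1, 1, 0] \<bullet> mom y = y \<bullet> y"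
      by (simp add: inner_6 mom_def inner_vec_def sum_3 power2_eq_square)
    then have 1: "n \<bullet> \<alpha> = 1 - \<kappa> * snd \<alpha>"
      using y by (simp add: n_def lift_def norm_eq_1)
    have "snd \<alpha> \<le> B"
      using B[OF \<alpha>] norm_snd_le[of "snd \<alpha>" "fst \<alpha>"] by simp
    then have "\<kappa> * snd \<alpha> \<le> \<kappa> * B"
      using \<kappa> by simp
    then show ?thesis
      using \<kappa>(2) by (simp add: 1)
  qed
  then have "insert (0, - 1) A \<subseteq> {\<alpha>. 0 < n \<bullet> \<alpha>}"
    using \<kappa> by (auto simp: n_def)
  then have "convex hull (insert (0, - 1) A) \<subseteq> {\<alpha>. 0 < n \<bullet> \<alpha>}"
    by (rule hull_minimal) (rule convex_halfspace_gt)
  then have "0 \<notin> convex hull (insert (0, - 1) A)"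
    by auto
  then show ?thesis
    unfolding ext_cone_def A_def[symmetric] using \<open>compact A\<close>
    by (auto simp: convex_cone_hull_separate_nonempty intro!: closed_conic_hull compact_convex_hull)
qed

text \<open>A separating functional with last entry \<open>- l\<close>, divided by \<open>l\<close>,
  is the dual vector. The generator \<open>(0, - 1)\<close> gives the sign of \<open>l\<close>, and
  the point \<open>(m, v0)\<close> excludes vertical hyperplanes.\<close>

lemma separation_ext_cone:
  assumes "(m, v) \<notin> ext_cone Q" "(m, v0) \<in> ext_cone Q"
  obtains z where "\<And>k y. y \<in> nonneg3 \<Longrightarrow> Q k \<bullet> mom y \<le> z \<bullet> mom y" "z \<bullet> m < v"
proof -
  note cone = convex_cone_ext_cone[of Q]
  obtain n b where n: "n \<bullet> (m, v) < b" "\<And>\<alpha>. \<alpha> \<in> ext_cone Q \<Longrightarrow> b < n \<bullet> \<alpha>"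
    using separating_hyperplane_closed_point[OF _ closed_ext_cone assms(1)] cone
    unfolding convex_cone_def by metis
  have b: "b < 0"
    using n(2)[OF convex_cone_contains_0[OF cone]] by simp
  have pos: "0 \<le> n \<bullet> \<alpha>" if "\<alpha> \<in> ext_cone Q" for \<alpha>
  proof (rule ccontr)
    assume "\<not> 0 \<le> n \<bullet> \<alpha>"
    then have "b / (n \<bullet> \<alpha>) \<ge> 0" "n \<bullet> ((b / (n \<bullet> \<alpha>)) *\<^sub>R \<alpha>) = b"
      using b by (auto simp: divide_nonpos_nonpos)
    with n(2)[OF convex_cone_scaleR[OF cone _ that]] show False
      by fastforce
  qed
  obtain z l where nz: "n = (z, - l)"
    by (metis minus_minus surj_pair)
  have "(0, - 1) \<in> ext_cone Q"
    unfolding ext_cone_def by (intro hull_inc) auto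
  from pos[OF this] have l: "0 \<le> l"
    by (simp add: nz)
  \<comment> \<open>For \<open>l = 0\<close> the functional would agree at \<open>(m, v)\<close>,
    where it is negative, and at \<open>(m, v0)\<close>, where it is not.\<close>
  moreover have "l \<noteq> 0"
    using pos[OF assms(2)] n(1) b by (auto simp: nz)
  ultimately have l: "0 < l"
    by simp
  show ?thesis
  proof
    show "Q k \<bullet> mom y \<le> (z /\<^sub>R l) \<bullet> mom y" if "y \<in> nonneg3" for k y
      using pos[OF lift_mom_in_ext_cone[OF that, of Q k]] l
      by (simp add: nz lift_def field_simps)
    show "(z /\<^sub>R l) \<bullet> m < v"
      using n(1) b l by (simp add: nz field_simps)
  qed
qed

section \<open>The cone of finitely supported measures on the quadrant\<close>

text \<open>Weights are not normalised: the total mass is the first coordinate of \<open>N\<close>.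
  The slack in \<open>v\<close> matches the generator \<open>(0, - 1)\<close> of
  \<open>ext_cone\<close>.\<close>

definition atomic_cone :: "(real^2 \<Rightarrow> real) \<Rightarrow> ((real^6) \<times> real) set" where
  "atomic_cone F = {(N, v). \<exists>S p. finite S \<and> (\<forall>x\<in>S. 0 \<le> x$1 \<and> 0 \<le> x$2 \<and> 0 \<le> p x) \<and>
     N = (\<Sum>x\<in>S. p x *\<^sub>R mom (vector [1, x$1, x$2])) \<and> v \<le> (\<Sum>x\<in>S. p x * F x)}"

lemma atomic_cone_downward: "(N, v) \<in> atomic_cone F \<Longrightarrow> v' \<le> v \<Longrightarrow> (N, v') \<in> atomic_cone F"
  unfolding atomic_cone_def by fastforce

lemma atomic_coneE:
  assumes "\<alpha> \<in> atomic_cone F"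
  obtains N v S p where "\<alpha> = (N, v)" "finite S" "\<forall>x\<in>S. 0 \<le> x$1 \<and> 0 \<le> x$2 \<and> 0 \<le> p x"
    "N = (\<Sum>x\<in>S. p x *\<^sub>R mom (vector [1, x$1, x$2]))" "v \<le> (\<Sum>x\<in>S. p x * F x)"
  using assms unfolding atomic_cone_def by auto

lemma convex_cone_atomic_cone: "convex_cone (atomic_cone F)"
  unfolding convex_cone_iff
proof (intro conjI ballI allI impI)
  show "0 \<in> atomic_cone F"
    unfolding atomic_cone_def zero_prod_def by (auto intro!: exI[of _ "{}"])
next
  fix \<alpha> \<alpha>' assume \<alpha>: "\<alpha> \<in> atomic_cone F" and \<alpha>': "\<alpha>' \<in> atomic_cone F"
  from \<alpha> obtain N v S p where
    A: "\<alpha> = (N, v)" "finite S" "\<forall>x\<in>S. 0 \<le> x$1 \<and> 0 \<le> x$2 \<and> 0 \<le> p x"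
      "N = (\<Sum>x\<in>S. p x *\<^sub>R mom (vector [1, x$1, x$2]))" "v \<le> (\<Sum>x\<in>S. p x * F x)"
    by (elim atomic_coneE)
  from \<alpha>' obtain N' v' S' p' where
    B: "\<alpha>' = (N', v')" "finite S'" "\<forall>x\<in>S'. 0 \<le> x$1 \<and> 0 \<le> x$2 \<and> 0 \<le> p' x"
      "N' = (\<Sum>x\<in>S'. p' x *\<^sub>R mom (vector [1, x$1, x$2]))" "v' \<le> (\<Sum>x\<in>S'. p' x * F x)"
    by (elim atomic_coneE)
  define r where "r x = (if x \<in> S then p x else 0) + (if x \<in> S' then p' x else 0)" for x
  have sums: "(\<Sum>x\<in>S \<union> S'. r x *\<^sub>R h x) = (\<Sum>x\<in>S. p x *\<^sub>R h x) + (\<Sum>x\<in>S'. p' x *\<^sub>R h x)"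
    for h :: "real^2 \<Rightarrow> 'b::real_vector"
  proof -
    have "(\<Sum>x\<in>S \<union> S'. r x *\<^sub>R h x) = (\<Sum>x\<in>S \<union> S'. (if x \<in> S then p x *\<^sub>R h x else 0))
        + (\<Sum>x\<in>S \<union> S'. (if x \<in> S' then p' x *\<^sub>R h x else 0))"
      unfolding sum.distrib[symmetric] by (intro sum.cong) (auto simp: r_def scaleR_add_left)
    also have "(\<Sum>x\<in>S \<union> S'. (if x \<in> S then p x *\<^sub>R h x else 0)) = (\<Sum>x\<in>S. p x *\<^sub>R h x)"
      using A(2) B(2) by (intro sum.mono_neutral_cong_right) auto
    also have "(\<Sum>x\<in>S \<union> S'. (if x \<in> S' then p' x *\<^sub>R h x else 0)) = (\<Sum>x\<in>S'. p' x *\<^sub>R h x)"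
      using A(2) B(2) by (intro sum.mono_neutral_cong_right) auto
    finally show ?thesis .
  qed
  show "\<alpha> + \<alpha>' \<in> atomic_cone F"
    unfolding atomic_cone_def A(1) B(1) add_Pair mem_Collect_eq split_conv
    using A B sums[of F] sums[of "\<lambda>x. mom (vector [1, x$1, x$2])"]
    by (intro exI[of _ "S \<union> S'"] exI[of _ r]) (auto simp: r_def)
next
  fix \<alpha> and c :: real assume "\<alpha> \<in> atomic_cone F" "0 \<le> c"
  then obtain N v S p where
    A: "\<alpha> = (N, v)" "finite S" "\<forall>x\<in>S. 0 \<le> x$1 \<and> 0 \<le> x$2 \<and> 0 \<le> p x"
      "N = (\<Sum>x\<in>S. p x *\<^sub>R mom (vector [1, x$1, x$2]))" "v \<le> (\<Sum>x\<in>S. p x * F x)"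
    by (elim atomic_coneE)
  show "c *\<^sub>R \<alpha> \<in> atomic_cone F"
    unfolding atomic_cone_def A(1) scaleR_Pair mem_Collect_eq split_conv
    using A \<open>0 \<le> c\<close>
    by (intro exI[of _ S] exI[of _ "\<lambda>x. c * p x"])
      (auto simp: scaleR_right.sum sum_distrib_left[symmetric] mult.assoc mult_left_mono)
qed

text \<open>As \<open>mom\<close> is quadratic, \<open>y\<close> is an atom of mass
  \<open>(y$1)\<^sup>2\<close> at the point with coordinates \<open>y$2 / y$1\<close> and
  \<open>y$3 / y$1\<close>.\<close>

lemma lift_mom_in_atomic_cone:
  assumes F: "\<And>x. 0 \<le> x$1 \<Longrightarrow> 0 \<le> x$2 \<Longrightarrow> quad_fun w x \<le> F x"
    and y: "y \<in> nonneg3" "0 < y$1"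
  shows "lift w (mom y) \<in> atomic_cone F"
proof -
  define x :: "real^2" where "x = vector [y$2 / y$1, y$3 / y$1]"
  have x: "0 \<le> x$1" "0 \<le> x$2"
    using y by (auto simp: x_def nonneg3_def)
  have "y = y$1 *\<^sub>R vector [1, x$1, x$2]"
    using y by (simp add: x_def vec_eq_iff forall_3)
  then have mom: "mom y = (y$1)\<^sup>2 *\<^sub>R mom (vector [1, x$1, x$2])"
    by (metis mom_scaleR)
  have "w \<bullet> mom y = (y$1)\<^sup>2 * quad_fun w x"
    by (simp add: mom quad_fun_eq_mom)
  also have "\<dots> \<le> (y$1)\<^sup>2 * F x"
    using F[OF x] by (simp add: mult_left_mono)
  finally show ?thesis
    unfolding atomic_cone_def lift_def mem_Collect_eq split_conv using x mom
    by (intro exI[of _ "{x}"] exI[of _ "\<lambda>_. (y$1)\<^sup>2"]) auto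
qed

section \<open>Moving atoms at infinity to finite positions\<close>

text \<open>A rotation in the plane of \<open>g\<close> and \<open>y\<close> preserves the sum of the two moment vectors, and a
  small one makes the first coordinates of both vectors positive. Hence an atom \<open>y\<close> at infinity can
  be moved to a finite position at the expense of an arbitrarily small part of \<open>g\<close>.\<close>

lemma atomic_cone_rotation:
  assumes F: "\<And>x. 0 \<le> x$1 \<Longrightarrow> 0 \<le> x$2 \<Longrightarrow> quad_fun w x \<le> F x"
    and g: "g \<in> nonneg3" "0 < g$1"
    and y: "y \<in> nonneg3" "\<And>i. 0 < y$i \<Longrightarrow> 0 < g$i"
    and t: "0 < t"
  shows "lift w (t *\<^sub>R mom g + mom y) \<in> atomic_cone F"
proof -
  define h where "h = sqrt t *\<^sub>R g"
  have h: "h \<in> nonneg3" "0 < h$1" "\<And>i. 0 < y$i \<Longrightarrow> 0 < h$i" "mom h = t *\<^sub>R mom g"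
    using g y t by (auto simp: h_def nonneg3_def mom_scaleR)
  \<comment> \<open>The weak bound keeps \<open>h - s *\<^sub>R y\<close> nonnegative, also where
    \<open>h$i = 0\<close> and hence \<open>y$i = 0\<close>; the strict one keeps its first
    coordinate positive.\<close>
  have small: "\<forall>\<^sub>F s in at_right 0. s * y$i \<le> h$i \<and> (0 < h$i \<longrightarrow> s * y$i < h$i)" for i
  proof (cases "0 < h$i")
    case True
    have "((\<lambda>s. s * y$i) \<longlongrightarrow> 0 * y$i) (at_right 0)"
      by (intro tendsto_intros)
    then have "\<forall>\<^sub>F s in at_right 0. s * y$i < h$i"
      using True by (intro order_tendstoD(2)) auto
    then show ?thesis
      by eventually_elim auto
  next
    case False
    then have "y$i = 0" "h$i = 0"
      using h y(1) by (auto simp: nonneg3_def less_eq_real_def)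
    then show ?thesis
      by simp
  qed
  have "\<forall>\<^sub>F s in at_right 0. \<forall>i. s * y$i \<le> h$i \<and> (0 < h$i \<longrightarrow> s * y$i < h$i)"
    by (intro eventually_all_finite small)
  then have "\<forall>\<^sub>F s in at_right 0. 0 < s \<and> (\<forall>i. s * y$i \<le> h$i \<and> (0 < h$i \<longrightarrow> s * y$i < h$i))"
    using eventually_at_right_less by (intro eventually_conj)
  then have "\<exists>s>0. \<forall>i. s * y$i \<le> h$i \<and> (0 < h$i \<longrightarrow> s * y$i < h$i)"
    by (rule eventually_happens'[rotated]) simp
  then obtain s where s: "0 < s" "\<And>i. s * y$i \<le> h$i" "s * y$1 < h$1"
    using h(2) by blast
  have p: "lift w (mom (h - s *\<^sub>R y)) \<in> atomic_cone F"
    using s by (intro lift_mom_in_atomic_cone F) (auto simp: nonneg3_def)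
  have q: "lift w (mom (y + s *\<^sub>R h)) \<in> atomic_cone F"
    using s h y by (intro lift_mom_in_atomic_cone F) (auto simp: nonneg3_def add_nonneg_pos)
  have eq: "mom (h - s *\<^sub>R y) + mom (y + s *\<^sub>R h) = (1 + s\<^sup>2) *\<^sub>R (mom h + mom y)"
    by (simp add: vec_eq_iff forall_6 mom_def power2_eq_square algebra_simps)
  have "lift w ((1 + s\<^sup>2) *\<^sub>R (mom h + mom y)) \<in> atomic_cone F"
    unfolding eq[symmetric] lift_add by (rule convex_cone_add[OF convex_cone_atomic_cone p q])
  then have "(1 / (1 + s\<^sup>2)) *\<^sub>R lift w ((1 + s\<^sup>2) *\<^sub>R (mom h + mom y)) \<in> atomic_cone F"
    by (intro convex_cone_scaleR[OF convex_cone_atomic_cone]) auto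
  moreover have "1 + s\<^sup>2 \<noteq> 0"
    using zero_le_power2[of s] by linarith
  ultimately show ?thesis
    by (simp add: lift_scaleR[symmetric] h(4))
qed

text \<open>Replacing the share t of \<open>m\<close> by the moments of \<open>e\<close> and
  \<open>e'\<close> frees t times the moments of \<open>g\<close> and \<open>g'\<close>. This finite
  reserve pays for rotating every atom at infinity, at a loss in value of order t.\<close>

lemma ext_cone_approximation:
  fixes Q :: "'k::finite \<Rightarrow> real^6"
  assumes F: "\<And>k x. 0 \<le> x$1 \<Longrightarrow> 0 \<le> x$2 \<Longrightarrow> quad_fun (Q k) x \<le> F x"
    and m: "m = mom g + mom g' + mom e + mom e'"
    and nn: "g \<in> nonneg3" "g' \<in> nonneg3" "e \<in> nonneg3" "e' \<in> nonneg3" "0 < g$1" "0 < g'$1"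
    and supp: "\<And>y. y \<in> nonneg3 \<Longrightarrow> (m$6 = 0 \<Longrightarrow> y$2 * y$3 = 0) \<Longrightarrow>
      (\<forall>i. 0 < y$i \<longrightarrow> 0 < g$i) \<or> (\<forall>i. 0 < y$i \<longrightarrow> 0 < g'$i)"
    and mv: "(m, v) \<in> ext_cone Q" and "v' < v"
  shows "(m, v') \<in> atomic_cone F"
proof -
  let ?G = "atomic_cone F"
  note cone = convex_cone_atomic_cone[of F]
  define \<Gamma> where "\<Gamma> = mom g + mom g'"
  \<comment> \<open>The reserve must serve whichever piece a generator uses, so its value is the
    worst over \<open>k\<close>.\<close>
  define \<beta> where "\<beta> = (\<Gamma>, Min (range (\<lambda>k. Q k \<bullet> \<Gamma>)))"
  have atom: "lift (Q k) (t *\<^sub>R \<Gamma> + mom y) \<in> ?G"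
    if y: "y \<in> nonneg3" "m$6 = 0 \<Longrightarrow> y$2 * y$3 = 0" and t: "0 < t" for k y t
  proof -
    have *: "lift (Q k) (t *\<^sub>R (mom p + mom q) + mom y) \<in> ?G"
      if "p \<in> nonneg3" "q \<in> nonneg3" "0 < p$1" "0 < q$1" "\<forall>i. 0 < y$i \<longrightarrow> 0 < p$i" for p q
    proof -
      have "lift (Q k) (t *\<^sub>R mom p + mom y) + t *\<^sub>R lift (Q k) (mom q) \<in> ?G"
        using that t y(1) F
        by (intro convex_cone_add[OF cone] convex_cone_scaleR[OF cone] atomic_cone_rotation
              lift_mom_in_atomic_cone) auto
      then show ?thesis
        by (simp add: lift_add[symmetric] lift_scaleR[symmetric] algebra_simps)
    qed
    from supp y have "(\<forall>i. 0 < y$i \<longrightarrow> 0 < g$i) \<or> (\<forall>i. 0 < y$i \<longrightarrow> 0 < g'$i)"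
      by auto
    then show ?thesis
      unfolding \<Gamma>_def using *[of g g'] *[of g' g] nn by (auto simp: add.commute[of "mom g'"])
  qed
  have \<beta>_lift: "t *\<^sub>R \<beta> + lift (Q k) (mom y) \<in> ?G"
    if "y \<in> nonneg3" "m$6 = 0 \<Longrightarrow> y$2 * y$3 = 0" "0 < t" for k y t
  proof -
    have "Min (range (\<lambda>k. Q k \<bullet> \<Gamma>)) \<le> Q k \<bullet> \<Gamma>"
      by (intro Min_le) auto
    then have "t * Min (range (\<lambda>k. Q k \<bullet> \<Gamma>)) + Q k \<bullet> mom y \<le> Q k \<bullet> (t *\<^sub>R \<Gamma> + mom y)"
      using that(3) by (simp add: inner_add_right mult_left_mono)
    with atom[OF that, of k] show ?thesis
      unfolding \<beta>_def lift_def by (auto intro: atomic_cone_downward)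
  qed
  have \<beta>: "t *\<^sub>R \<beta> \<in> ?G" if "0 < t" for t
    using \<beta>_lift[of 0 t undefined] that
    by (simp add: nonneg3_def lift_def zero_prod_def[symmetric])
  \<comment> \<open>Stated for every \<open>t > 0\<close> so that a sum can split the reserve into
    halves. If \<open>m$6 = 0\<close>, only atoms on the axes may occur; nonnegativity of the sixth
    moments passes this on from a sum to its summands.\<close>
  define H where "H = {\<alpha>. 0 \<le> fst \<alpha> $ 6 \<and>
    ((m$6 = 0 \<longrightarrow> fst \<alpha> $ 6 = 0) \<longrightarrow> (\<forall>t>0. t *\<^sub>R \<beta> + \<alpha> \<in> ?G))}"
  have "convex_cone H"
    unfolding convex_cone_iff
  proof (intro conjI ballI allI impI)
    show "0 \<in> H"
      using \<beta> by (simp add: H_def)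
    show "\<alpha> + \<alpha>' \<in> H" if \<alpha>: "\<alpha> \<in> H" "\<alpha>' \<in> H" for \<alpha> \<alpha>'
    proof -
      have "t *\<^sub>R \<beta> + (\<alpha> + \<alpha>') \<in> ?G"
        if "0 < t" "m$6 = 0 \<Longrightarrow> fst \<alpha> $ 6 + fst \<alpha>' $ 6 = 0" for t
      proof -
        have "m$6 = 0 \<longrightarrow> fst \<alpha> $ 6 = 0" "m$6 = 0 \<longrightarrow> fst \<alpha>' $ 6 = 0"
          using \<alpha> that(2) by (auto simp: H_def add_nonneg_eq_0_iff)
        then have "(t / 2) *\<^sub>R \<beta> + \<alpha> \<in> ?G" "(t / 2) *\<^sub>R \<beta> + \<alpha>' \<in> ?G"
          using \<alpha> that(1) by (auto simp: H_def)
        then have "((t / 2) *\<^sub>R \<beta> + \<alpha>) + ((t / 2) *\<^sub>R \<beta> + \<alpha>') \<in> ?G"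
          by (rule convex_cone_add[OF cone])
        also have "((t / 2) *\<^sub>R \<beta> + \<alpha>) + ((t / 2) *\<^sub>R \<beta> + \<alpha>') = t *\<^sub>R \<beta> + (\<alpha> + \<alpha>')"
          by (simp add: add_ac) (simp add: add.assoc[symmetric] scaleR_add_left[symmetric])
        finally show ?thesis .
      qed
      then show ?thesis
        using \<alpha> by (auto simp: H_def)
    qed
    show "c *\<^sub>R \<alpha> \<in> H" if \<alpha>: "\<alpha> \<in> H" and c: "0 \<le> c" for \<alpha> c
    proof (cases "c = 0")
      case True
      then show ?thesis
        using \<beta> by (simp add: H_def)
    next
      case False
      have "t *\<^sub>R \<beta> + c *\<^sub>R \<alpha> \<in> ?G" if "0 < t" "m$6 = 0 \<Longrightarrow> fst \<alpha> $ 6 = 0" for t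
      proof -
        have "c *\<^sub>R ((t / c) *\<^sub>R \<beta> + \<alpha>) \<in> ?G"
          using \<alpha> that c False by (intro convex_cone_scaleR[OF cone]) (auto simp: H_def)
        then show ?thesis
          using False by (simp add: scaleR_add_right)
      qed
      then show ?thesis
        using \<alpha> c False by (auto simp: H_def)
    qed
  qed
  moreover have "(0, - 1) \<in> H"
  proof -
    have "t *\<^sub>R \<beta> + (0, - 1) \<in> ?G" if "0 < t" for t
      using \<beta>[OF that] unfolding \<beta>_def by (auto intro: atomic_cone_downward)
    then show ?thesis
      by (simp add: H_def)
  qed
  moreover have "lift (Q k) (mom y) \<in> H" if "y \<in> nonneg3" for k y
    using \<beta>_lift that by (auto simp: H_def lift_def mom_def nonneg3_def)
  ultimately have H: "ext_cone Q \<subseteq> H"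
    unfolding ext_cone_def by (intro hull_minimal) auto
  define v1 where "v1 = Q undefined \<bullet> (mom e + mom e')"
  note E = convex_cone_ext_cone[of Q]
  have rest: "(mom e + mom e', v1) \<in> ext_cone Q"
    using convex_cone_add[OF E lift_mom_in_ext_cone[OF nn(3), of Q undefined]
        lift_mom_in_ext_cone[OF nn(4), of Q undefined]]
    by (simp add: lift_def v1_def inner_add_right)
  define d where "d = v1 + snd \<beta> - v"
  have mix: "(m, v + t * d) \<in> ?G" if t: "0 < t" "t < 1" for t
  proof -
    have eq: "(1 - t) *\<^sub>R (m, v) + t *\<^sub>R (mom e + mom e', v1) = (m - t *\<^sub>R \<Gamma>, v + t * (v1 - v))"
      by (simp add: m \<Gamma>_def algebra_simps)
    have "(1 - t) *\<^sub>R (m, v) + t *\<^sub>R (mom e + mom e', v1) \<in> ext_cone Q"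
      using t by (intro convex_cone_add[OF E] convex_cone_scaleR[OF E] mv rest) auto
    then have "(m - t *\<^sub>R \<Gamma>, v + t * (v1 - v)) \<in> H"
      using H unfolding eq by blast
    \<comment> \<open>Ensures that the sixth moment of \<open>m - t *\<^sub>R \<Gamma>\<close>
      vanishes with that of \<open>m\<close>, as \<open>H\<close> demands.\<close>
    moreover have "\<Gamma> $ 6 = 0" if "m $ 6 = 0"
    proof -
      have "0 \<le> g$2 * g$3" "0 \<le> g'$2 * g'$3" "0 \<le> e$2 * e$3" "0 \<le> e'$2 * e'$3"
        using nn by (auto simp: nonneg3_def)
      then show ?thesis
        using that by (simp add: m \<Gamma>_def mom_def)
    qed
    ultimately have "t *\<^sub>R \<beta> + (m - t *\<^sub>R \<Gamma>, v + t * (v1 - v)) \<in> ?G"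
      using t by (auto simp: H_def)
    then show ?thesis
      by (simp add: \<beta>_def d_def algebra_simps)
  qed
  define t where "t = min (1 / 2) ((v - v') / (\<bar>d\<bar> + 1))"
  have t: "0 < t" "t < 1"
    using \<open>v' < v\<close> by (auto simp: t_def)
  have "t * \<bar>d\<bar> \<le> (v - v') / (\<bar>d\<bar> + 1) * (\<bar>d\<bar> + 1)"
    using t by (intro mult_mono) (auto simp: t_def)
  moreover have "t * - d \<le> t * \<bar>d\<bar>"
    using t by (intro mult_left_mono) auto
  ultimately have "v' \<le> v + t * d"
    by simp
  with mix[OF t] show ?thesis
    by (rule atomic_cone_downward)
qed

section \<open>Realising atoms by probability measures, and weak duality\<close>

lemma discrete_measure_exists:
  fixes p :: "'a::{second_countable_topology, t1_space} \<Rightarrow> real"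
  assumes S: "finite S" and p: "\<And>x. x \<in> S \<Longrightarrow> 0 \<le> p x" "(\<Sum>x\<in>S. p x) = 1"
  shows "\<exists>P. prob_space P \<and> sets P = sets borel \<and> (AE x in P. x \<in> S) \<and>
    (\<forall>h\<in>borel_measurable borel. has_bochner_integral P h (\<Sum>x\<in>S. p x * h x :: real))"
proof -
  define f where "f x = (if x \<in> S then p x else 0)" for x
  have f: "\<And>x. 0 \<le> f x"
    using p by (simp add: f_def)
  have "(\<integral>\<^sup>+x. ennreal (f x) \<partial>count_space UNIV) = (\<Sum>x\<in>S. ennreal (f x))"
    using S by (intro nn_integral_count_space') (auto simp: f_def)
  also have "\<dots> = ennreal (\<Sum>x\<in>S. f x)"
    using f by (intro sum_ennreal) auto
  also have "\<dots> = 1"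
    using p(2) by (simp add: f_def)
  finally have f1: "(\<integral>\<^sup>+x. ennreal (f x) \<partial>count_space UNIV) = 1" .
  define M where "M = embed_pmf f"
  have pmf: "pmf M x = f x" for x
    unfolding M_def by (rule pmf_embed_pmf[OF f f1])
  have supp: "set_pmf M \<subseteq> S"
    by (auto simp: set_pmf_eq pmf f_def split: if_splits)
  \<comment> \<open>Under the discrete distribution every set is measurable; the push-forward to
    \<open>borel\<close> has the sigma-algebra that \<open>moment_dists\<close> demands.\<close>
  define P where "P = distr (measure_pmf M) borel (\<lambda>x. x)"
  show ?thesis
  proof (intro exI[of _ P] conjI ballI)
    show "prob_space P"
      unfolding P_def by (intro measure_pmf.prob_space_distr) simp
    show "sets P = sets borel"
      by (simp add: P_def)
    have "{x \<in> space borel. x \<in> S} \<in> sets borel"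
      using S by (simp add: finite_imp_closed borel_closed)
    then show "AE x in P. x \<in> S"
      unfolding P_def using supp by (subst AE_distr_iff) (auto simp: AE_measure_pmf_iff)
    fix h :: "'a \<Rightarrow> real" assume h: "h \<in> borel_measurable borel"
    have "integrable P h"
      unfolding P_def using h S supp
      by (subst integrable_distr_eq) (auto intro: integrable_measure_pmf_finite finite_subset)
    moreover have "integral\<^sup>L P h = (\<Sum>x\<in>S. p x * h x)"
    proof -
      have "integral\<^sup>L P h = (\<integral>x. h x \<partial>measure_pmf M)"
        unfolding P_def using h by (subst integral_distr) auto
      also have "\<dots> = (\<Sum>x\<in>S. h x * pmf M x)"
        using S supp by (intro integral_measure_pmf_real) auto
      finally show ?thesis
        by (simp add: pmf f_def mult.commute)
    qed
    ultimately show "has_bochner_integral P h (\<Sum>x\<in>S. p x * h x)"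
      by (simp add: has_bochner_integral_iff)
  qed
qed

lemma borel_measurable_quad_fun [measurable]: "quad_fun w \<in> borel_measurable borel"
  unfolding quad_fun_def by measurable

lemma moment_dists_if_atomic_cone:
  assumes "(vector [1, \<mu>\<^sub>1, \<mu>\<^sub>2, \<Sigma>\<^sub>1\<^sub>1, \<Sigma>\<^sub>2\<^sub>2, \<Sigma>\<^sub>1\<^sub>2], v) \<in> atomic_cone F" "F \<in> borel_measurable borel"
  shows "\<exists>P\<in>moment_dists \<mu>\<^sub>1 \<mu>\<^sub>2 \<Sigma>\<^sub>1\<^sub>1 \<Sigma>\<^sub>2\<^sub>2 \<Sigma>\<^sub>1\<^sub>2. v \<le> prob_space.expectation P F"
proof -
  obtain S p where S: "finite S" "\<And>x. x \<in> S \<Longrightarrow> 0 \<le> x$1 \<and> 0 \<le> x$2 \<and> 0 \<le> p x"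
    and m: "vector [1, \<mu>\<^sub>1, \<mu>\<^sub>2, \<Sigma>\<^sub>1\<^sub>1, \<Sigma>\<^sub>2\<^sub>2, \<Sigma>\<^sub>1\<^sub>2] = (\<Sum>x\<in>S. p x *\<^sub>R mom (vector [1, x$1, x$2]))"
    and v: "v \<le> (\<Sum>x\<in>S. p x * F x)"
    using assms(1) unfolding atomic_cone_def by blast
  have sums: "(\<Sum>x\<in>S. p x) = 1" "(\<Sum>x\<in>S. p x * x$1) = \<mu>\<^sub>1" "(\<Sum>x\<in>S. p x * x$2) = \<mu>\<^sub>2"
    "(\<Sum>x\<in>S. p x * (x$1)\<^sup>2) = \<Sigma>\<^sub>1\<^sub>1" "(\<Sum>x\<in>S. p x * (x$2)\<^sup>2) = \<Sigma>\<^sub>2\<^sub>2" "(\<Sum>x\<in>S. p x * (x$1 * x$2)) = \<Sigma>\<^sub>1\<^sub>2"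
    using m by (simp_all add: vec_eq_iff forall_6 mom_def)
  obtain P where P: "prob_space P" "sets P = sets borel" "AE x in P. x \<in> S"
    and int: "\<forall>h\<in>borel_measurable borel. has_bochner_integral P h (\<Sum>x\<in>S. p x * h x)"
    using discrete_measure_exists[OF S(1) _ sums(1)] S(2) by blast
  have "P \<in> moment_dists \<mu>\<^sub>1 \<mu>\<^sub>2 \<Sigma>\<^sub>1\<^sub>1 \<Sigma>\<^sub>2\<^sub>2 \<Sigma>\<^sub>1\<^sub>2"
    unfolding moment_dists_def mem_Collect_eq sums(2-6)[symmetric]
    using P(1,2) S eventually_mono[OF P(3), of "\<lambda>x. 0 \<le> x$1 \<and> 0 \<le> x$2"]
    by (intro conjI bspec[OF int, of "\<lambda>x. x$1"] bspec[OF int, of "\<lambda>x. x$2"]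
          bspec[OF int, of "\<lambda>x. (x$1)\<^sup>2"] bspec[OF int, of "\<lambda>x. (x$2)\<^sup>2"]
          bspec[OF int, of "\<lambda>x. x$1 * x$2"]) auto
  moreover have "prob_space.expectation P F = (\<Sum>x\<in>S. p x * F x)"
    using bspec[OF int assms(2)] by (rule has_bochner_integral_integral_eq)
  ultimately show ?thesis
    using v by (intro bexI[of _ P]) simp_all
qed

lemma integrable_Max:
  fixes f :: "'i \<Rightarrow> 'a \<Rightarrow> real"
  assumes "finite I" "I \<noteq> {}" "\<And>i. i \<in> I \<Longrightarrow> integrable M (f i)"
  shows "integrable M (\<lambda>x. Max ((\<lambda>i. f i x) ` I))"
  using assms by (induction I rule: finite_ne_induct) auto

text \<open>The prescribed moments make every quadratic integrable, hence also the finite maximum,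
  and they determine the expectation of \<open>quad_fun z\<close>, which is the dual
  objective.\<close>

lemma expectation_le_if_dominated:
  fixes Q :: "'k::finite \<Rightarrow> real^6"
  assumes P: "P \<in> moment_dists \<mu>\<^sub>1 \<mu>\<^sub>2 \<Sigma>\<^sub>1\<^sub>1 \<Sigma>\<^sub>2\<^sub>2 \<Sigma>\<^sub>1\<^sub>2"
    and le: "\<And>k x. 0 \<le> x$1 \<Longrightarrow> 0 \<le> x$2 \<Longrightarrow> quad_fun (Q k) x \<le> quad_fun z x"
  shows "prob_space.expectation P (\<lambda>x. MAX k. quad_fun (Q k) x)
    \<le> z \<bullet> vector [1, \<mu>\<^sub>1, \<mu>\<^sub>2, \<Sigma>\<^sub>1\<^sub>1, \<Sigma>\<^sub>2\<^sub>2, \<Sigma>\<^sub>1\<^sub>2]"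
proof -
  interpret prob_space P
    using P by (simp add: moment_dists_def)
  have quad: "has_bochner_integral P (quad_fun w) (w \<bullet> vector [1, \<mu>\<^sub>1, \<mu>\<^sub>2, \<Sigma>\<^sub>1\<^sub>1, \<Sigma>\<^sub>2\<^sub>2, \<Sigma>\<^sub>1\<^sub>2])" for w
  proof -
    have "has_bochner_integral P (\<lambda>x. w$1) (w$1)"
      by (simp add: has_bochner_integral_iff prob_space)
    then have "has_bochner_integral P (\<lambda>x. w$1 + w$2 * x$1 + w$3 * x$2 + w$4 * (x$1)\<^sup>2
        + w$5 * (x$2)\<^sup>2 + w$6 * (x$1 * x$2))
        (w$1 + w$2 * \<mu>\<^sub>1 + w$3 * \<mu>\<^sub>2 + w$4 * \<Sigma>\<^sub>1\<^sub>1 + w$5 * \<Sigma>\<^sub>2\<^sub>2 + w$6 * \<Sigma>\<^sub>1\<^sub>2)"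
      using P unfolding moment_dists_def mem_Collect_eq
      by (intro has_bochner_integral_add has_bochner_integral_mult_right) auto
    then show ?thesis
      by (simp add: quad_fun_def[abs_def] inner_6)
  qed
  have "expectation (\<lambda>x. MAX k. quad_fun (Q k) x) \<le> expectation (quad_fun z)"
  proof (rule integral_mono_AE)
    show "integrable P (\<lambda>x. MAX k. quad_fun (Q k) x)"
      using quad by (intro integrable_Max) (auto simp: has_bochner_integral_iff)
    show "integrable P (quad_fun z)"
      using quad by (auto simp: has_bochner_integral_iff)
    have "AE x in P. 0 \<le> x$1 \<and> 0 \<le> x$2"
      using P by (simp add: moment_dists_def)
    then show "AE x in P. (MAX k. quad_fun (Q k) x) \<le> quad_fun z x"
      by eventually_elim (auto intro!: Max.boundedI le)
  qed
  also have "\<dots> = z \<bullet> vector [1, \<mu>\<^sub>1, \<mu>\<^sub>2, \<Sigma>\<^sub>1\<^sub>1, \<Sigma>\<^sub>2\<^sub>2, \<Sigma>\<^sub>1\<^sub>2]"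
    using quad by (rule has_bochner_integral_integral_eq)
  finally show ?thesis .
qed

section \<open>Splitting the prescribed moments into a reserve and a remainder\<close>

text \<open>The matrix with rows \<open>(1, 1, 1)\<close>, \<open>(1, a, c)\<close>, \<open>(1, c, b)\<close> of normalised moments is reduced by
  the pivot 1 if \<open>1 \<le> c\<close>, and otherwise by the pivot \<open>a\<close>; in either case the Schur complement has
  nonnegative entries, so it is completely positive.\<close>

lemma moment_decomposition:
  fixes \<mu>\<^sub>1 \<mu>\<^sub>2 a b c :: real
  assumes \<mu>: "\<mu>\<^sub>1 > 0" "\<mu>\<^sub>2 > 0" and a: "a > 1" and c: "c \<ge> 0"
    and det: "(a - 1) * (b - 1) \<ge> (c - 1)\<^sup>2"
    and m: "m = vector [1, \<mu>\<^sub>1, \<mu>\<^sub>2, a * \<mu>\<^sub>1\<^sup>2, b * \<mu>\<^sub>2\<^sup>2, c * \<mu>\<^sub>1 * \<mu>\<^sub>2]"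
  obtains g g' e e' where "m = mom g + mom g' + mom e + mom e'"
    "g \<in> nonneg3" "g' \<in> nonneg3" "e \<in> nonneg3" "e' \<in> nonneg3" "0 < g$1" "0 < g'$1"
    "\<And>y. y \<in> nonneg3 \<Longrightarrow> (m$6 = 0 \<Longrightarrow> y$2 * y$3 = 0) \<Longrightarrow>
      (\<forall>i. 0 < y$i \<longrightarrow> 0 < g$i) \<or> (\<forall>i. 0 < y$i \<longrightarrow> 0 < g'$i)"
proof -
  \<comment> \<open>The last pivot of the normalised moment matrix: its determinant over the leading
    minor \<open>a - 1\<close>, the same in both orders of elimination.\<close>
  define r where "r = ((a - 1) * (b - 1) - (c - 1)\<^sup>2) / (a - 1)"
  have r: "0 \<le> r"
    using a det by (simp add: r_def)
  show ?thesis
  proof (cases "1 \<le> c")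
    case True
    \<comment> \<open>The atom at the mean has full support; it is halved to serve as both
      \<open>g\<close> and \<open>g'\<close>. The vectors \<open>e\<close> and \<open>e'\<close> lie
      at infinity and are nonnegative by \<open>1 \<le> c\<close>.\<close>
    define g e e' :: "real^3" where "g = sqrt (1 / 2) *\<^sub>R vector [1, \<mu>\<^sub>1, \<mu>\<^sub>2]"
      and "e = sqrt (1 / (a - 1)) *\<^sub>R vector [0, (a - 1) * \<mu>\<^sub>1, (c - 1) * \<mu>\<^sub>2]"
      and "e' = sqrt r *\<^sub>R vector [0, 0, \<mu>\<^sub>2]"
    have mom: "mom g = (1 / 2) *\<^sub>R mom (vector [1, \<mu>\<^sub>1, \<mu>\<^sub>2])"
      "mom e = (1 / (a - 1)) *\<^sub>R mom (vector [0, (a - 1) * \<mu>\<^sub>1, (c - 1) * \<mu>\<^sub>2])"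
      "mom e' = r *\<^sub>R mom (vector [0, 0, \<mu>\<^sub>2])"
      unfolding g_def e_def e'_def mom_scaleR using a r by simp_all
    have b: "b = 1 + (c - 1)\<^sup>2 / (a - 1) + r"
      unfolding r_def diff_divide_distrib using a by simp
    show ?thesis
    proof (rule that[of g g e e'])
      show "m = mom g + mom g + mom e + mom e'"
        unfolding m mom b using a
        by (simp add: vec_eq_iff forall_6 mom_def field_simps power2_eq_square)
    qed (use True \<mu> a r in \<open>auto simp: nonneg3_def forall_3 g_def e_def e'_def\<close>)
  next
    case False
    \<comment> \<open>The entries left in the first row after elimination with the pivot
      \<open>a\<close>; \<open>q\<close> is positive because \<open>c < 1 < a\<close>.\<close>
    define p q where "p = 1 - 1 / a" and "q = 1 - c / a"
    have pq: "0 < p" "0 < q"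
      using a False by (auto simp: p_def q_def)
    define g g' e :: "real^3" where "g = sqrt (1 / a) *\<^sub>R vector [1, a * \<mu>\<^sub>1, c * \<mu>\<^sub>2]"
      and "g' = sqrt (1 / p) *\<^sub>R vector [p, 0, q * \<mu>\<^sub>2]"
      and "e = sqrt r *\<^sub>R vector [0, 0, \<mu>\<^sub>2]"
    have mom: "mom g = (1 / a) *\<^sub>R mom (vector [1, a * \<mu>\<^sub>1, c * \<mu>\<^sub>2])"
      "mom g' = (1 / p) *\<^sub>R mom (vector [p, 0, q * \<mu>\<^sub>2])"
      "mom e = r *\<^sub>R mom (vector [0, 0, \<mu>\<^sub>2])"
      unfolding g_def e_def g'_def mom_scaleR using a r pq by simp_all
    have p: "p = (a - 1) / a" and q: "q = (a - c) / a"
      using a by (auto simp: p_def q_def field_simps)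
    have "q\<^sup>2 / p = (a - c)\<^sup>2 / (a * (a - 1))"
      unfolding p q using a by (simp add: divide_simps power2_eq_square)
    moreover have "b = c\<^sup>2 / a + (a - c)\<^sup>2 / (a * (a - 1)) + r"
      using a by (simp add: r_def divide_simps) algebra
    ultimately have b: "b = c\<^sup>2 / a + q\<^sup>2 / p + r"
      by simp
    have q1: "c / a + q = 1" and p1: "1 / a + p = 1"
      by (auto simp: p_def q_def)
    have "mom g + mom g' + mom e =
      vector [1 / a + p, \<mu>\<^sub>1, (c / a + q) * \<mu>\<^sub>2, a * \<mu>\<^sub>1\<^sup>2, (c\<^sup>2 / a + q\<^sup>2 / p + r) * \<mu>\<^sub>2\<^sup>2, c * \<mu>\<^sub>1 * \<mu>\<^sub>2]"
      unfolding mom using a pq(1)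
      by (simp add: vec_eq_iff forall_6 mom_def power2_eq_square algebra_simps)
    then have "m = mom g + mom g' + mom e + mom 0"
      unfolding m q1 p1 b[symmetric] by simp
    then show ?thesis
    proof (rule that[of g g' e 0])
      fix y assume y: "y \<in> nonneg3" "m$6 = 0 \<Longrightarrow> y$2 * y$3 = 0"
      show "(\<forall>i. 0 < y$i \<longrightarrow> 0 < g$i) \<or> (\<forall>i. 0 < y$i \<longrightarrow> 0 < g'$i)"
      \<comment> \<open>The support of \<open>g\<close> is full if \<open>c > 0\<close> and misses
        the third coordinate if \<open>c = 0\<close>; that of \<open>g'\<close> misses the
        second.\<close>
      proof (cases "y$2 = 0 \<or> c > 0")
        case True
        then show ?thesis
          using \<mu> a pq by (auto simp: forall_3 g_def g'_def)
      next
        case False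
        then have "c = 0"
          using c by simp
        then have "y$3 = 0"
          using y(2) False by (simp add: m)
        then show ?thesis
          using \<mu> a by (simp add: forall_3 g_def)
      qed
    qed (use \<mu> a c r pq in \<open>auto simp: nonneg3_def forall_3 g_def g'_def e_def\<close>)
  qed
qed

section \<open>Equality of the two optimal values\<close>

theorem proposition2:
  fixes \<mu>\<^sub>1 \<mu>\<^sub>2 a b c \<Sigma>\<^sub>1\<^sub>1 \<Sigma>\<^sub>2\<^sub>2 \<Sigma>\<^sub>1\<^sub>2 :: real
    and W :: "real^'k^6"
  assumes "\<mu>\<^sub>1 > 0" and "\<mu>\<^sub>2 > 0"
    and "a > 1" and "b > 1" and "c \<ge> 0"
    and "(a - 1) * (b - 1) \<ge> (c - 1)\<^sup>2"
    and "\<Sigma>\<^sub>1\<^sub>1 = a * \<mu>\<^sub>1\<^sup>2" and "\<Sigma>\<^sub>2\<^sub>2 = b * \<mu>\<^sub>2\<^sup>2" and "\<Sigma>\<^sub>1\<^sub>2 = c * \<mu>\<^sub>1 * \<mu>\<^sub>2"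
  shows "(SUP P\<in>moment_dists \<mu>\<^sub>1 \<mu>\<^sub>2 \<Sigma>\<^sub>1\<^sub>1 \<Sigma>\<^sub>2\<^sub>2 \<Sigma>\<^sub>1\<^sub>2.
            ereal (prob_space.expectation P (\<lambda>x. MAX k. quad_fun (column k W) x))) =
         (INF (z, G, H)\<in>{(z :: real^6, G :: real^'k^3, H :: real^'k^3).
              \<forall>k. psd (lmi_matrix (z - column k W) (column k G) (column k H))}.
            ereal (z$1 + \<mu>\<^sub>1 * z$2 + \<mu>\<^sub>2 * z$3 + \<Sigma>\<^sub>1\<^sub>1 * z$4 + \<Sigma>\<^sub>2\<^sub>2 * z$5 + \<Sigma>\<^sub>1\<^sub>2 * z$6))"
    (is "?sup = ?inf")
proof -
  define Q where "Q k = column k W" for k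
  define m :: "real^6" where "m = vector [1, \<mu>\<^sub>1, \<mu>\<^sub>2, \<Sigma>\<^sub>1\<^sub>1, \<Sigma>\<^sub>2\<^sub>2, \<Sigma>\<^sub>1\<^sub>2]"
  define F where "F x = (MAX k. quad_fun (Q k) x)" for x
  have F_ge: "quad_fun (Q k) x \<le> F x" for k x
    unfolding F_def by (intro Max_ge) auto
  have F_borel: "F \<in> borel_measurable borel"
    unfolding F_def by measurable
  have quad_diff: "quad_fun (z - w) x = quad_fun z x - quad_fun w x" for z w x
    by (simp add: quad_fun_eq_mom inner_diff_left)
  have obj: "z$1 + \<mu>\<^sub>1 * z$2 + \<mu>\<^sub>2 * z$3 + \<Sigma>\<^sub>1\<^sub>1 * z$4 + \<Sigma>\<^sub>2\<^sub>2 * z$5 + \<Sigma>\<^sub>1\<^sub>2 * z$6 = z \<bullet> m" for z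
    by (simp add: m_def inner_6 mult.commute)
  obtain g g' e e' where dec: "m = mom g + mom g' + mom e + mom e'"
    "g \<in> nonneg3" "g' \<in> nonneg3" "e \<in> nonneg3" "e' \<in> nonneg3" "0 < g$1" "0 < g'$1"
    "\<And>y. y \<in> nonneg3 \<Longrightarrow> (m$6 = 0 \<Longrightarrow> y$2 * y$3 = 0) \<Longrightarrow>
      (\<forall>i. 0 < y$i \<longrightarrow> 0 < g$i) \<or> (\<forall>i. 0 < y$i \<longrightarrow> 0 < g'$i)"
    using moment_decomposition[OF assms(1-3,5,6) m_def[unfolded assms(7-9)]] by blast
  have m0: "lift (Q k) m \<in> ext_cone Q" for k
    unfolding dec(1) lift_add
    by (intro convex_cone_add[OF convex_cone_ext_cone] lift_mom_in_ext_cone dec(2-5))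
  have "?sup \<le> ?inf"
  proof (intro SUP_least INF_greatest, clarify)
    fix P z and G H :: "real^'k^3"
    assume P: "P \<in> moment_dists \<mu>\<^sub>1 \<mu>\<^sub>2 \<Sigma>\<^sub>1\<^sub>1 \<Sigma>\<^sub>2\<^sub>2 \<Sigma>\<^sub>1\<^sub>2"
      and psd: "\<forall>k. psd (lmi_matrix (z - column k W) (column k G) (column k H))"
    have "quad_fun (Q k) x \<le> quad_fun z x" if "0 \<le> x$1" "0 \<le> x$2" for k x
      using quad_fun_nonneg_if_psd[OF psd[rule_format] that] by (simp add: quad_diff Q_def)
    from expectation_le_if_dominated[OF P this]
    show "ereal (prob_space.expectation P (\<lambda>x. MAX k. quad_fun (column k W) x)) \<le>
      ereal (z$1 + \<mu>\<^sub>1 * z$2 + \<mu>\<^sub>2 * z$3 + \<Sigma>\<^sub>1\<^sub>1 * z$4 + \<Sigma>\<^sub>2\<^sub>2 * z$5 + \<Sigma>\<^sub>1\<^sub>2 * z$6)"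
      by (simp add: obj m_def Q_def)
  qed
  moreover have "?inf \<le> ?sup"
  proof (rule ccontr)
    assume "\<not> ?inf \<le> ?sup"
    then have "?sup < ?inf"
      by (simp only: not_le)
    \<comment> \<open>Two levels inside the gap: \<open>v\<close> for membership in the closed cone,
      and the smaller \<open>v'\<close> for what finite atoms attain.\<close>
    from ereal_dense2[OF this] obtain v' where v': "?sup < ereal v'" "ereal v' < ?inf"
      by blast
    from ereal_dense2[OF v'(2)] obtain v where v: "v' < v" "ereal v < ?inf"
      by auto
    \<comment> \<open>Otherwise separation yields a dual feasible \<open>z\<close> with objective
      below \<open>v\<close>, hence below the infimum.\<close>
    have "(m, v) \<in> ext_cone Q"
    proof (rule ccontr)
      assume "(m, v) \<notin> ext_cone Q"
      then obtain z where z: "\<And>k y. y \<in> nonneg3 \<Longrightarrow> Q k \<bullet> mom y \<le> z \<bullet> mom y" "z \<bullet> m < v"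
        using separation_ext_cone[OF _ m0[unfolded lift_def]] by blast
      have "\<exists>g. psd (lmi_matrix (z - Q k) g 0)" for k
        using z(1) by (intro psd_lmi_matrix_if_copositive) (simp add: nonneg3_def inner_diff_left)
      then obtain g where g: "\<And>k. psd (lmi_matrix (z - Q k) (g k) 0)"
        by metis
      define G :: "real^'k^3" where "G = (\<chi> i k. g k $ i)"
      have "column k G = g k" "column k (0 :: real^'k^3) = 0" for k
        by (simp_all add: column_def G_def vec_eq_iff)
      then have "?inf \<le> ereal (z \<bullet> m)"
        using g by (intro INF_lower2[of "(z, G, 0)"]) (auto simp: obj Q_def)
      then show False
        using less_le_trans[OF v(2)] z(2) by force
    qed
    from ext_cone_approximation[OF F_ge dec this v(1)] have "(m, v') \<in> atomic_cone F" .
    then obtain P where "P \<in> moment_dists \<mu>\<^sub>1 \<mu>\<^sub>2 \<Sigma>\<^sub>1\<^sub>1 \<Sigma>\<^sub>2\<^sub>2 \<Sigma>\<^sub>1\<^sub>2" "v' \<le> prob_space.expectation P F"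
      using moment_dists_if_atomic_cone[OF _ F_borel] unfolding m_def by blast
    then have "ereal v' \<le> ?sup"
      by (intro SUP_upper2[of P]) (auto simp: F_def[abs_def] Q_def)
    then show False
      using v'(1) by simp
  qed
  ultimately show ?thesis
    by (rule antisym)
qed

end
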